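(* Let $n\ge1$, $0=b_0<b_1<\cdots<b_n<b_{n+1}=1$, $\mathbf c=(c_0,\dots,c_n)^T\in\mathbb R^{n+1}$, $\alpha\in\mathbb R$, and let $a,r,f$ be real-valued functions on $I=(0,1)$ with $a,r\in L^\infty(I)$, $a\ge a_0>0$ and $r\ge r_0\ge 0$ a.e. on $I$ for constants $a_0,r_0$. Let $\tilde h_i=\min\{h_{i-1},h_i\}$. If for all $i=1,\dots,n$ one has $c_i\ne0$, $a$ is differentiable at $b_i$, and $$\frac{g_i}{c_i}+\frac{r_0\tilde h_i}{4}>0,$$ then the matrix $\mathbf D(\mathbf g)\mathbf D(\hat{\mathbf c})^{-1}+A_r(\mathbf b)$ is positive definite.
   Context: $\sigma(t)=\max\{0,t\}$; $H$ is the Heaviside function ($H(t)=1$ for $t>0$, $H(0)=\tfrac12$, $H(t)=0$ for $t<0$); $\mathbf b=(b_1,\dots,b_n)^T$; $h_i=b_{i+1}-b_i$ for $i=0,\dots,n$. Let $u_n(x)=\alpha+c_0x+\sum_{i=1}^n c_i\sigma(x-b_i)$, and set $u_n'(b_i):=\sum_{l=0}^{i-1}c_l+\frac{c_i}{2}$. For $i=1,\dots,n$ define $g_i=r(b_i)u_n(b_i)-f(b_i)-a'(b_i)u_n'(b_i)$. Then $\mathbf D(\mathbf g)=\mathrm{diag}(g_1,\dots,g_n)$, $\hat{\mathbf c}=(c_1,\dots,c_n)^T$, $\mathbf D(\hat{\mathbf c})=\mathrm{diag}(c_1,\dots,c_n)$, and $A_r(\mathbf b)$ is the $n\times n$ matrix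 with entries $\int_0^1 r(x)H(x-b_i)H(x-b_j)\,dx$, $i,j=1,\dots,n$. *)

theory Defs
  imports "HOL-Analysis.Analysis" "Jordan_Normal_Form.Gauss_Jordan_Elimination"
begin

text \<open>
  Breakpoints \<open>b\<close> and coefficients \<open>c\<close> are functions on \<open>nat\<close> indexed as in the mathematics:
  only \<open>b 0, \<dots>, b (n + 1)\<close> and \<open>c 0, \<dots>, c n\<close> are ever used. Matrices are 0-based, so row
  (or column) \<open>k\<close> belongs to the breakpoint \<open>b (k + 1)\<close>.
\<close>

abbreviation unit_I :: "real set" where
  "unit_I \<equiv> {0<..<1}"

text \<open>Membership in \<open>L\<^sup>\<infinity>(S)\<close>; values outside \<open>S\<close> are irrelevant.\<close>

definition L_infinity_on :: "real set \<Rightarrow> (real \<Rightarrow> real) \<Rightarrow> bool" where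
  "L_infinity_on S q \<longleftrightarrow>
     q \<in> borel_measurable (lebesgue_on S) \<and> (\<exists>C. AE x in lebesgue_on S. \<bar>q x\<bar> \<le> C)"

definition relu :: "real \<Rightarrow> real" where
  "relu t = max 0 t"

definition heaviside :: "real \<Rightarrow> real" where
  "heaviside t = (if t > 0 then 1 else if t = 0 then 1/2 else 0)"

definition mesh :: "(nat \<Rightarrow> real) \<Rightarrow> nat \<Rightarrow> real" where
  "mesh b i = b (i + 1) - b i"

definition mesh_min :: "(nat \<Rightarrow> real) \<Rightarrow> nat \<Rightarrow> real" where
  "mesh_min b i = min (mesh b (i - 1)) (mesh b i)"

definition relu_net :: "nat \<Rightarrow> real \<Rightarrow> (nat \<Rightarrow> real) \<Rightarrow> (nat \<Rightarrow> real) \<Rightarrow> real \<Rightarrow> real" where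
  "relu_net n \<alpha> c b x = \<alpha> + c 0 * x + (\<Sum>i=1..n. c i * relu (x - b i))"

text \<open>
  The value assigned to the derivative of \<^const>\<open>relu_net\<close> at the breakpoint \<open>b i\<close>, where the
  network has a kink: the mean of the two one-sided slopes.
\<close>

definition relu_net_slope :: "(nat \<Rightarrow> real) \<Rightarrow> nat \<Rightarrow> real" where
  "relu_net_slope c i = (\<Sum>l<i. c l) + c i / 2"

definition g_coeff :: "nat \<Rightarrow> real \<Rightarrow> (nat \<Rightarrow> real) \<Rightarrow> (nat \<Rightarrow> real) \<Rightarrow>
    (real \<Rightarrow> real) \<Rightarrow> (real \<Rightarrow> real) \<Rightarrow> (real \<Rightarrow> real) \<Rightarrow> nat \<Rightarrow> real" where
  "g_coeff n \<alpha> c b a r f i =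
     r (b i) * relu_net n \<alpha> c b (b i) - f (b i) - deriv a (b i) * relu_net_slope c i"

definition diag_of :: "nat \<Rightarrow> (nat \<Rightarrow> real) \<Rightarrow> real mat" where
  "diag_of n v = mat_diag n (\<lambda>k. v (k + 1))"

text \<open>
  \<^const>\<open>mat_inverse\<close> returns an option; this is the inverse for invertible matrices and
  unspecified otherwise.
\<close>

definition inv_mat :: "real mat \<Rightarrow> real mat" where
  "inv_mat M = the (mat_inverse M)"

definition A_mat :: "nat \<Rightarrow> (real \<Rightarrow> real) \<Rightarrow> (nat \<Rightarrow> real) \<Rightarrow> real mat" where
  "A_mat n r b = Matrix.mat n n (\<lambda>(i, j).
     LINT x:unit_I|lebesgue. r x * heaviside (x - b (i + 1)) * heaviside (x - b (j + 1)))"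

definition positive_definite :: "real mat \<Rightarrow> bool" where
  "positive_definite M \<longleftrightarrow> square_mat M \<and> transpose_mat M = M \<and>
     (\<forall>v \<in> carrier_vec (dim_row M). v \<noteq> 0\<^sub>v (dim_row M) \<longrightarrow> scalar_prod v (M *\<^sub>v v) > 0)"

end

theory Submission
  imports Defs
begin

text \<open>
  Write \<open>s k\<close> for the sum of the first \<open>k\<close> entries of a vector \<open>v\<close>. The step function
  \<open>\<Sum>i. v i * H (x - b i)\<close> equals \<open>s k\<close> on the \<open>k\<close>-th mesh interval, so the quadratic form of
  \<open>A\<^sub>r\<close> at \<open>v\<close> is at least \<open>r0 * (\<Sum>k. h k * (s k)\<^sup>2)\<close>. Every entry of \<open>v\<close> is a jump of \<open>s\<close>, hence
  its square is at most twice the sum of the squares of two neighbouring values of \<open>s\<close>, and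
  each value of \<open>s\<close> neighbours at most two jumps. This bounds the form of \<open>A\<^sub>r\<close> below by
  \<open>r0 / 4 * (\<Sum>i. min (h (i - 1)) (h i) * (v i)\<^sup>2)\<close>, which compensates the diagonal part.
\<close>

lemma sum_min_mult_jump_sq_le:
  fixes h s :: "nat \<Rightarrow> real"
  assumes "\<And>i. i \<le> n \<Longrightarrow> h i \<ge> 0"
  shows "(\<Sum>i<n. min (h i) (h (Suc i)) * (s (Suc i) - s i)\<^sup>2) \<le> 4 * (\<Sum>i\<le>n. h i * (s i)\<^sup>2)"
proof -
  have jump: "min (h i) (h (Suc i)) * (s (Suc i) - s i)\<^sup>2
      \<le> 2 * (h i * (s i)\<^sup>2) + 2 * (h (Suc i) * (s (Suc i))\<^sup>2)" if "i < n" for i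
  proof -
    let ?m = "min (h i) (h (Suc i))"
    have "(s (Suc i) - s i)\<^sup>2 \<le> 2 * (s i)\<^sup>2 + 2 * (s (Suc i))\<^sup>2"
      \<comment> \<open>The right side minus the left side is exactly the square of the sum of the
        two values.\<close>
      using zero_le_power2[of "s (Suc i) + s i"] by (simp add: power2_eq_square algebra_simps)
    moreover have "?m \<ge> 0"
      using that assms by simp
    ultimately have "?m * (s (Suc i) - s i)\<^sup>2 \<le> ?m * (2 * (s i)\<^sup>2 + 2 * (s (Suc i))\<^sup>2)"
      by (rule mult_left_mono)
    also have "\<dots> = 2 * (?m * (s i)\<^sup>2) + 2 * (?m * (s (Suc i))\<^sup>2)"
      by (simp only: algebra_simps)
    also have "\<dots> \<le> 2 * (h i * (s i)\<^sup>2) + 2 * (h (Suc i) * (s (Suc i))\<^sup>2)"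
      by (intro add_mono mult_left_mono mult_right_mono) auto
    finally show ?thesis .
  qed
  have "(\<Sum>i<n. min (h i) (h (Suc i)) * (s (Suc i) - s i)\<^sup>2)
      \<le> 2 * (\<Sum>i<n. h i * (s i)\<^sup>2) + 2 * (\<Sum>i<n. h (Suc i) * (s (Suc i))\<^sup>2)"
    using sum_mono[OF jump, of "{..<n}" "\<lambda>i. i"] by (simp add: sum.distrib sum_distrib_left)
  moreover have "(\<Sum>i<n. h i * (s i)\<^sup>2) \<le> (\<Sum>i\<le>n. h i * (s i)\<^sup>2)"
    using assms by (intro sum_mono2) auto
  \<comment> \<open>Shifting the index loses only the term at 0, which is nonnegative.\<close>
  moreover have "(\<Sum>i<n. h (Suc i) * (s (Suc i))\<^sup>2) \<le> (\<Sum>i\<le>n. h i * (s i)\<^sup>2)"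
    using assms[of 0] by (simp add: sum.atMost_shift)
  ultimately show ?thesis
    by linarith
qed

section \<open>Step functions on the mesh\<close>

lemma breakpoints_mono:
  fixes b :: "nat \<Rightarrow> real"
  assumes "\<And>i. i \<le> n \<Longrightarrow> b i < b (Suc i)" "i \<le> j" "j \<le> Suc n"
  shows "b i \<le> b j"
  using assms(2,3)
proof (induction j rule: dec_induct)
  case (step k)
  then show ?case
    using assms(1)[of k] by simp
qed simp

text \<open>Inside the interval, \<open>b 1\<close> to \<open>b k\<close> lie to the left of
  \<open>x\<close> and the later breakpoints to the right; strictness avoids the value 1/2 at 0. The
  weight \<open>w i\<close> is attached to \<open>b (Suc i)\<close>, so exactly the first
  \<open>k\<close> weights are switched on.\<close>

lemma step_function_on_mesh_interval:
  fixes b w :: "nat \<Rightarrow> real"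
  assumes b: "\<And>i. i \<le> n \<Longrightarrow> b i < b (Suc i)" and "k \<le> n" and x: "b k < x" "x < b (Suc k)"
  shows "(\<Sum>i<n. w i * heaviside (x - b (Suc i))) = (\<Sum>i<k. w i)"
proof -
  have "heaviside (x - b (Suc i)) = (if i < k then 1 else 0)" if "i < n" for i
  proof (cases "i < k")
    case True
    then have "b (Suc i) \<le> b k"
      using breakpoints_mono[of n b "Suc i" k] b \<open>k \<le> n\<close> by simp
    then show ?thesis
      using True x by (simp add: heaviside_def)
  next
    case False
    then have "b (Suc k) \<le> b (Suc i)"
      using breakpoints_mono[of n b "Suc k" "Suc i"] b that by simp
    then show ?thesis
      using False x by (simp add: heaviside_def)
  qed
  then have "(\<Sum>i<n. w i * heaviside (x - b (Suc i))) = (\<Sum>i<n. if i < k then w i else 0)"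
    by (intro sum.cong) auto
  also have "\<dots> = (\<Sum>i<k. w i)"
    using \<open>k \<le> n\<close> by (intro sum.mono_neutral_cong_right) auto
  finally show ?thesis .
qed

text \<open>The open mesh intervals are disjoint, so at most one indicator survives, and there
  equality holds. At breakpoints and outside the mesh the left side vanishes, so the bound holds at
  every point without excluding a null set.\<close>

lemma step_function_sq_ge:
  fixes b w :: "nat \<Rightarrow> real"
  assumes b: "\<And>i. i \<le> n \<Longrightarrow> b i < b (Suc i)"
  shows "(\<Sum>k\<le>n. (\<Sum>i<k. w i)\<^sup>2 * indicator {b k<..<b (Suc k)} x)
    \<le> (\<Sum>i<n. w i * heaviside (x - b (Suc i)))\<^sup>2"
proof (cases "\<exists>k\<le>n. x \<in> {b k<..<b (Suc k)}")
  case True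
  then obtain k where k: "k \<le> n" "b k < x" "x < b (Suc k)"
    by auto
  have "x \<notin> {b l<..<b (Suc l)}" if "l \<le> n" "l \<noteq> k" for l
  proof (cases "l < k")
    case True
    then have "b (Suc l) \<le> b k"
      using breakpoints_mono[of n b "Suc l" k] b k(1) by simp
    then show ?thesis
      using k by auto
  next
    case False
    then have "b (Suc k) \<le> b l"
      using breakpoints_mono[of n b "Suc k" l] b that by simp
    then show ?thesis
      using k by auto
  qed
  then have "(\<Sum>l\<le>n. (\<Sum>i<l. w i)\<^sup>2 * indicator {b l<..<b (Suc l)} x)
      = (\<Sum>l\<in>{k}. (\<Sum>i<l. w i)\<^sup>2 * indicator {b l<..<b (Suc l)} x)"
    using k(1) by (intro sum.mono_neutral_right) auto
  then show ?thesis
    using step_function_on_mesh_interval[where b = b, OF b k] k by simp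
next
  case False
  then have "(\<Sum>k\<le>n. (\<Sum>i<k. w i)\<^sup>2 * indicator {b k<..<b (Suc k)} x) = 0"
    by (intro sum.neutral) auto
  then show ?thesis
    by simp
qed

section \<open>Measurability and integrability\<close>

lemma borel_measurable_heaviside [measurable]: "heaviside \<in> borel_measurable borel"
  unfolding heaviside_def by measurable

lemma abs_heaviside_le: "\<bar>heaviside t\<bar> \<le> 1"
  by (simp add: heaviside_def)

lemma set_integrable_sum_family:
  fixes q :: "'i \<Rightarrow> 'a \<Rightarrow> 'b :: {banach, second_countable_topology}"
  assumes "\<And>i. i \<in> I \<Longrightarrow> set_integrable M A (q i)"
  shows "set_integrable M A (\<lambda>x. \<Sum>i\<in>I. q i x)"
    and "(LINT x:A|M. \<Sum>i\<in>I. q i x) = (\<Sum>i\<in>I. LINT x:A|M. q i x)"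
  using assms by (simp_all add: set_integrable_def set_lebesgue_integral_def scaleR_sum_right)

lemma set_integrable_L_infinity_mult:
  fixes q \<phi> :: "real \<Rightarrow> real"
  assumes "L_infinity_on unit_I q" and \<phi>: "\<phi> \<in> borel_measurable borel" "\<And>x. \<bar>\<phi> x\<bar> \<le> B"
  shows "set_integrable lebesgue unit_I (\<lambda>x. q x * \<phi> x)"
proof -
  obtain C where q: "q \<in> borel_measurable (lebesgue_on unit_I)"
    and C: "AE x in lebesgue_on unit_I. \<bar>q x\<bar> \<le> C"
    using assms(1) by (auto simp: L_infinity_on_def)
  have fin: "finite_measure (lebesgue_on unit_I)"
    by (rule finite_measure_lebesgue_on) simp
  have "\<phi> \<in> borel_measurable (lebesgue_on unit_I)"
    using \<phi>(1) by (simp add: borel_measurable_if_D measurable_completion measurable_restrict_space1)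
  then have "(\<lambda>x. q x * \<phi> x) \<in> borel_measurable (lebesgue_on unit_I)"
    using q by simp
  \<comment> \<open>Absolute values around \<open>C\<close> and \<open>B\<close> supply the signs
    needed to multiply the two bounds.\<close>
  moreover have "AE x in lebesgue_on unit_I. norm (q x * \<phi> x) \<le> \<bar>C\<bar> * \<bar>B\<bar>"
    using C
  proof eventually_elim
    case (elim x)
    then show ?case
      using \<phi>(2)[of x] by (auto simp: abs_mult intro!: mult_mono)
  qed
  ultimately have "integrable (lebesgue_on unit_I) (\<lambda>x. q x * \<phi> x)"
    by (intro finite_measure.integrable_const_bound[OF fin])
  then show ?thesis
    by (simp add: integrable_restrict_space set_integrable_def)
qed

section \<open>Matrix inverse and quadratic forms\<close>

text \<open>Since \<open>inv_mat\<close> unwraps an option, two things are needed: an explicit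
  two-sided inverse makes the matrix a unit, which rules out \<open>None\<close>, and uniqueness of
  inverses identifies the matrix returned.\<close>

lemma inv_mat_diag_of:
  assumes "\<And>i. i \<in> {1..n} \<Longrightarrow> c i \<noteq> 0"
  shows "inv_mat (diag_of n c) = diag_of n (\<lambda>i. inverse (c i))"
proof -
  let ?D = "diag_of n c" and ?E = "diag_of n (\<lambda>i. inverse (c i))"
  have carrier: "?D \<in> carrier_mat n n" "?E \<in> carrier_mat n n"
    by (simp_all add: diag_of_def)
  have inverse: "?D * ?E = 1\<^sub>m n" "?E * ?D = 1\<^sub>m n"
    using assms by (auto simp: diag_of_def one_mat_def mat_diag_def mat_diag_diag[unfolded mat_diag_def])
  \<comment> \<open>The last argument of \<open>ring_mat\<close> only fills the record extension, so
    any value serves.\<close>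
  have "?D \<in> Units (ring_mat TYPE(real) n undefined)"
    using carrier inverse by (auto simp: Units_def ring_mat_simps)
  then obtain B where B: "mat_inverse ?D = Some B"
    using mat_inverse(1)[OF carrier(1), of undefined] by fastforce
  then have right_inverse: "?D * B = 1\<^sub>m n" and "B \<in> carrier_mat n n"
    using mat_inverse(2)[OF carrier(1) B] by auto
  then have "?E = ?E * (?D * B)"
    using carrier by simp
  also have "\<dots> = (?E * ?D) * B"
    using carrier \<open>B \<in> carrier_mat n n\<close> by (simp only: assoc_mult_mat)
  also have "\<dots> = B"
    using inverse \<open>B \<in> carrier_mat n n\<close> by simp
  finally have "B = ?E" ..
  then show ?thesis
    by (simp add: inv_mat_def B)
qed

lemma quadratic_form_eq:
  fixes M :: "real mat"
  assumes "M \<in> carrier_mat n n" "v \<in> carrier_vec n"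
  shows "scalar_prod v (M *\<^sub>v v)
    = (\<Sum>i<n. \<Sum>j<n. vec_index v i * M $$ (i, j) * vec_index v j)"
proof -
  have "vec_index (M *\<^sub>v v) i = (\<Sum>j<n. M $$ (i, j) * vec_index v j)" if "i < n" for i
    using assms that by (simp add: scalar_prod_def atLeast0LessThan)
  then show ?thesis
    using assms by (simp add: scalar_prod_def atLeast0LessThan sum_distrib_left mult.assoc)
qed

text \<open>The form is the integral of \<open>r\<close> times the square of the step function with
  jumps \<open>v\<close>. Almost everywhere \<open>r\<close> is at least \<open>r0\<close>, and the
  square dominates its restriction to the open mesh intervals, whose integral is explicit.\<close>

lemma A_mat_quadratic_form_ge:
  assumes b: "b 0 = 0" "b (Suc n) = 1" "\<And>i. i \<le> n \<Longrightarrow> b i < b (Suc i)"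
    and r: "L_infinity_on unit_I r" and "r0 \<ge> 0"
    and r_ge: "AE x in lebesgue_on unit_I. r x \<ge> r0"
    and v: "v \<in> carrier_vec n"
  shows "scalar_prod v (A_mat n r b *\<^sub>v v)
    \<ge> r0 * (\<Sum>k\<le>n. mesh b k * (\<Sum>i<k. vec_index v i)\<^sup>2)"
proof -
  define w where "w = vec_index v"
  define H where "H i x = heaviside (x - b (Suc i))" for i x
  define \<phi> where "\<phi> x = (\<Sum>i<n. w i * H i x)" for x
  define s where "s k = (\<Sum>i<k. w i)" for k
  define \<psi> where "\<psi> x = (\<Sum>k\<le>n. (s k)\<^sup>2 * indicator {b k<..<b (Suc k)} x)" for x :: real
  have [measurable]: "H i \<in> borel_measurable borel" for i
    unfolding H_def by measurable
  have H_le: "\<bar>H i x\<bar> \<le> 1" for i x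
    by (simp add: H_def abs_heaviside_le)
  have entry_integrable: "set_integrable lebesgue unit_I (\<lambda>x. w i * w j * (r x * (H i x * H j x)))"
    for i j
    using set_integrable_L_infinity_mult[OF r, of "\<lambda>x. H i x * H j x" 1] H_le
    by (intro set_integrable_mult_right) (auto simp: abs_mult mult_le_one)
  \<comment> \<open>Expanding the square produces the integrands of the matrix entries, weighted by
    \<open>w i * w j\<close>.\<close>
  have sq: "r x * (\<phi> x)\<^sup>2 = (\<Sum>i<n. \<Sum>j<n. w i * w j * (r x * (H i x * H j x)))" for x
    by (simp add: \<phi>_def power2_eq_square sum_product sum_distrib_left mult_ac)
  have sub: "{b k<..<b (Suc k)} \<subseteq> unit_I" if "k \<le> n" for k
    using breakpoints_mono[of n b 0 k] breakpoints_mono[of n b "Suc k" "Suc n"] b that by auto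
  \<comment> \<open>Restriction to \<open>unit_I\<close> is invisible on a mesh interval, so each
    term integrates to \<open>(s k)\<^sup>2\<close> times the full interval length.\<close>
  have unit_indicator: "indicator unit_I x * ((s k)\<^sup>2 * indicator {b k<..<b (Suc k)} x)
      = (s k)\<^sup>2 * indicator {b k<..<b (Suc k)} x" if "k \<le> n" for k and x :: real
    using sub[OF that] by (auto simp: indicator_def)
  have \<psi>_integrable: "set_integrable lebesgue unit_I \<psi>"
    unfolding \<psi>_def set_integrable_def real_scaleR_def sum_distrib_left
    by (intro Bochner_Integration.integrable_sum) (use b(3) in \<open>simp add: unit_indicator integrable_indicator_iff less_imp_le\<close>)
  have "scalar_prod v (A_mat n r b *\<^sub>v v)
      = (\<Sum>i<n. \<Sum>j<n. w i * w j * (LINT x:unit_I|lebesgue. r x * (H i x * H j x)))"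
    using v by (subst quadratic_form_eq[where n = n]) (auto simp: A_mat_def w_def H_def mult_ac)
  also have "\<dots> = (LINT x:unit_I|lebesgue. r x * (\<phi> x)\<^sup>2)"
    unfolding sq using entry_integrable
    by (simp add: set_integrable_sum_family del: set_integrable_mult_right_iff)
  also have "\<dots> \<ge> (LINT x:unit_I|lebesgue. r0 * \<psi> x)"
  proof -
    have "AE x in lebesgue. x \<in> unit_I \<longrightarrow> r x \<ge> r0"
      using r_ge by (simp add: AE_restrict_space_iff)
    then have "AE x in lebesgue. x \<in> unit_I \<longrightarrow> r0 * \<psi> x \<le> r x * (\<phi> x)\<^sup>2"
    proof eventually_elim
      case (elim x)
      have "\<psi> x \<le> (\<phi> x)\<^sup>2"
        using step_function_sq_ge[where b = b, OF b(3), of n w x]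
        by (simp add: \<psi>_def \<phi>_def s_def H_def)
      \<comment> \<open>Multiplying the two inequalities uses that \<open>r x\<close> and
        \<open>\<psi> x\<close> are nonnegative.\<close>
      then show ?case
        using elim \<open>r0 \<ge> 0\<close> by (auto intro!: mult_mono sum_nonneg simp: \<psi>_def)
    qed
    moreover have "set_integrable lebesgue unit_I (\<lambda>x. r x * (\<phi> x)\<^sup>2)"
      unfolding sq using entry_integrable by (intro set_integrable_sum_family(1)) auto
    ultimately show ?thesis
      using \<psi>_integrable by (intro set_integral_mono_AE) auto
  qed
  also have "(LINT x:unit_I|lebesgue. r0 * \<psi> x) = r0 * (LINT x:unit_I|lebesgue. \<psi> x)"
    by simp
  also have "(LINT x:unit_I|lebesgue. \<psi> x) = (\<Sum>k\<le>n. mesh b k * (s k)\<^sup>2)"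
    unfolding \<psi>_def set_lebesgue_integral_def real_scaleR_def sum_distrib_left
    using b(3)
    by (subst Bochner_Integration.integral_sum)
      (auto simp: unit_indicator mesh_def less_imp_le intro!: sum.cong)
  finally show ?thesis
    by (simp add: s_def w_def)
qed

theorem lemma5p2:
  fixes n :: nat and b c :: "nat \<Rightarrow> real" and \<alpha> a0 r0 :: real
    and a r f :: "real \<Rightarrow> real"
  assumes "n \<ge> 1"
    and "b 0 = 0" and "b (n + 1) = 1" and "\<forall>i\<le>n. b i < b (i + 1)"
    and "L_infinity_on unit_I a" and "L_infinity_on unit_I r"
    and "a0 > 0" and "AE x in lebesgue_on unit_I. a x \<ge> a0"
    and "r0 \<ge> 0" and "AE x in lebesgue_on unit_I. r x \<ge> r0"
    and "\<forall>i\<in>{1..n}. c i \<noteq> 0 \<and> a differentiable (at (b i)) \<and>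
           g_coeff n \<alpha> c b a r f i / c i + r0 * mesh_min b i / 4 > 0"
  shows "positive_definite
           (diag_of n (g_coeff n \<alpha> c b a r f) * inv_mat (diag_of n c) + A_mat n r b)"
proof -
  define d where "d i = g_coeff n \<alpha> c b a r f i / c i" for i
  let ?D = "diag_of n d" and ?A = "A_mat n r b"
  have prod_eq: "diag_of n (g_coeff n \<alpha> c b a r f) * inv_mat (diag_of n c) = ?D"
  proof -
    have "inv_mat (diag_of n c) = diag_of n (\<lambda>i. inverse (c i))"
      using assms(11) by (intro inv_mat_diag_of) auto
    then show ?thesis
      by (simp add: diag_of_def d_def divide_inverse)
  qed
  have carrier: "?D \<in> carrier_mat n n" "?A \<in> carrier_mat n n"
    by (simp_all add: diag_of_def A_mat_def)
  have "transpose_mat (?D + ?A) = ?D + ?A"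
    by (auto simp: diag_of_def A_mat_def mat_diag_def mult_ac)
  moreover have "scalar_prod v ((?D + ?A) *\<^sub>v v) > 0"
    if v: "v \<in> carrier_vec n" and v_nonzero: "v \<noteq> 0\<^sub>v n" for v
  proof -
    define w where "w = vec_index v"
    define s where "s k = (\<Sum>i<k. w i)" for k
    have pos: "d (Suc i) + r0 * mesh_min b (Suc i) / 4 > 0" if "i < n" for i
      using assms that by (auto simp: d_def)
    obtain i0 where i0: "i0 < n" "w i0 \<noteq> 0"
      using v v_nonzero eq_vecI[of v "0\<^sub>v n"] by (auto simp: w_def)
    \<comment> \<open>Strictness of the whole chain comes from here: a nonzero \<open>v\<close> has
      a nonzero entry \<open>w i0\<close>, and all the weights are positive.\<close>
    have "0 < (\<Sum>i<n. (d (Suc i) + r0 * mesh_min b (Suc i) / 4) * (w i)\<^sup>2)"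
      using i0 pos by (intro sum_pos2[of _ i0]) (auto simp: less_imp_le)
    also have "\<dots> = (\<Sum>i<n. d (Suc i) * (w i)\<^sup>2)
        + r0 / 4 * (\<Sum>i<n. mesh_min b (Suc i) * (w i)\<^sup>2)"
      by (simp add: sum.distrib sum_distrib_left algebra_simps)
    also have "\<dots> \<le> (\<Sum>i<n. d (Suc i) * (w i)\<^sup>2) + r0 * (\<Sum>k\<le>n. mesh b k * (s k)\<^sup>2)"
    proof -
      \<comment> \<open>The jump of the partial sums \<open>s\<close> from \<open>i\<close> to
        \<open>Suc i\<close> is \<open>w i\<close>. The constant 4 cancels the quarter in the
        hypothesis.\<close>
      have "(\<Sum>i<n. mesh_min b (Suc i) * (w i)\<^sup>2) \<le> 4 * (\<Sum>k\<le>n. mesh b k * (s k)\<^sup>2)"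
        using sum_min_mult_jump_sq_le[of n "mesh b" s] assms(4)
        by (simp add: mesh_def mesh_min_def s_def less_imp_le)
      from mult_left_mono[OF this, of "r0 / 4"] show ?thesis
        using \<open>r0 \<ge> 0\<close> by simp
    qed
    also have "\<dots> \<le> scalar_prod v (?D *\<^sub>v v) + scalar_prod v (?A *\<^sub>v v)"
    proof (rule add_mono)
      have "(\<Sum>j<n. w i * ?D $$ (i, j) * w j) = d (Suc i) * (w i)\<^sup>2" if "i < n" for i
      proof -
        have "(\<Sum>j<n. w i * ?D $$ (i, j) * w j)
            = (\<Sum>j<n. if j = i then d (Suc i) * (w i)\<^sup>2 else 0)"
          using that by (intro sum.cong)
            (auto simp: diag_of_def mat_diag_def power2_eq_square)
        then show ?thesis
          using that by simp
      qed
      then show "(\<Sum>i<n. d (Suc i) * (w i)\<^sup>2) \<le> scalar_prod v (?D *\<^sub>v v)"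
        unfolding quadratic_form_eq[OF carrier(1) v] by (simp add: w_def)
      show "r0 * (\<Sum>k\<le>n. mesh b k * (s k)\<^sup>2) \<le> scalar_prod v (?A *\<^sub>v v)"
        unfolding s_def w_def using assms v by (intro A_mat_quadratic_form_ge) auto
    qed
    also have "\<dots> = scalar_prod v ((?D + ?A) *\<^sub>v v)"
      using carrier v
      by (simp add: add_mult_distrib_mat_vec[OF carrier v] scalar_prod_add_distrib[of _ n])
    finally show ?thesis .
  qed
  ultimately show ?thesis
    using carrier unfolding prod_eq positive_definite_def by simp
qed

end
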